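(* Let $k$ be a field of characteristic zero and $N\ge2$. For the 2-cycle differential calculus on $S_N$, the 1-forms $$\alpha_i=-\theta_i,\qquad \theta_i=\sum_{j\neq i}e_{(ij)},\qquad i\in\{1,\dots,N\},$$ are flat connections with constant coefficients, i.e. $F(\alpha_i)=\mathrm{d}\alpha_i+\alpha_i^2=0$. Moreover the 1-forms $\theta_i$ obey $\theta_i\theta_j+\theta_j\theta_i=0$ for $i\neq j$.
   Context: Let $G=S_N$ and $\mathcal{C}\subset G$ the conjugacy class of 2-cycles. Let $k(G)$ be the algebra of functions $G\to k$, with $R_a(f)(g)=f(ga)$. Let $\Lambda^1=k\mathcal{C}$ with basis $\{e_a\}_{a\in\mathcal{C}}$ and $\Psi(e_a\otimes e_b)=e_{aba^{-1}}\otimes e_a$, and let $\Lambda_{quad}=T\Lambda^1/\langle\ker(\mathrm{id}-\Psi)\rangle$. The exterior algebra $\Omega$ is the graded algebra generated by $k(G)$ (degree 0) and $\Lambda_{quad}$ (with $e_a$ of degree 1), with cross relations $e_af=R_a(f)e_a$; it is free as a left $k(G)$-module, $\Omega=k(G)\otimes\Lambda_{quad}$. The differential is $\mathrm{d}\omega=\theta\omega-(-1)^{n}\omega\theta$ for $\omega\in\Omega^n$, where $\theta=\sum_{a\in\mathcal{C}}e_a$; in particular $\mathrm{d}e_a=\theta e_a+e_a\theta$. A ($U(1)$) connection is a 1-form $\alpha\in\Omega^1$; its curvature is $F(\alpha)=\mathrm{d}\alpha+\alpha^2$, and it is flat if $F(\alpha)=0$. It has constant coefficients if $\alpha\in\Lambda^1$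 (a $k$-linear combination of the $e_a$). *)

theory Defs
  imports "HOL-Algebra.Algebra"
begin

text \<open>
  Throughout, \<open>G\<close> is a (finite) group and \<open>C\<close> a conjugation-stable set of its elements; the field
  \<open>k\<close> is the type \<open>'k\<close>.  The space \<open>\<Lambda>\<^sup>1 = k C\<close> has basis \<open>e\<^sub>a\<close> with \<open>a \<in> C\<close>, so the tensor algebra
  \<open>T \<Lambda>\<^sup>1\<close> has as basis the words in \<open>C\<close>, the word \<open>[a\<^sub>1, \<dots>, a\<^sub>n]\<close> standing for
  \<open>e\<^bsub>a\<^sub>1\<^esub> \<otimes> \<dots> \<otimes> e\<^bsub>a\<^sub>n\<^esub>\<close>.  A tensor is the finitely supported function of its coefficients.
\<close>

definition word_tensor :: "'a list \<Rightarrow> 'a list \<Rightarrow> 'k::field" where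
  "word_tensor u = (\<lambda>w. if w = u then 1 else 0)"

definition tensor_alg :: "'a set \<Rightarrow> ('a list \<Rightarrow> 'k::field) ring" where
  "tensor_alg C =
    \<lparr> carrier = {x. finite {w. x w \<noteq> 0} \<and> {w. x w \<noteq> 0} \<subseteq> lists C},
      monoid.mult = (\<lambda>x y w. \<Sum>(u, v) | u @ v = w. x u * y v),
      one = word_tensor [],
      ring.zero = (\<lambda>w. 0),
      ring.add = (\<lambda>x y w. x w + y w) \<rparr>"

definition tensor_deg :: "'a set \<Rightarrow> nat \<Rightarrow> ('a list \<Rightarrow> 'k::field) set" where
  "tensor_deg C n = {x \<in> carrier (tensor_alg C). \<forall>w. x w \<noteq> 0 \<longrightarrow> length w = n}"

text \<open>
  The braiding \<open>\<Psi>\<close> is the linear map on \<open>\<Lambda>\<^sup>1 \<otimes> \<Lambda>\<^sup>1\<close> with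
  \<open>e\<^sub>a \<otimes> e\<^sub>b \<mapsto> e\<^bsub>aba\<^sup>-\<^sup>1\<^esub> \<otimes> e\<^sub>a\<close>.
\<close>

definition braiding ::
    "('a, 'm) monoid_scheme \<Rightarrow> 'a set \<Rightarrow> ('a list \<Rightarrow> 'k::field) \<Rightarrow> 'a list \<Rightarrow> 'k" where
  "braiding G C x =
    (\<lambda>w. \<Sum>a\<in>C. \<Sum>b\<in>C. x [a, b] * word_tensor [a \<otimes>\<^bsub>G\<^esub> b \<otimes>\<^bsub>G\<^esub> inv\<^bsub>G\<^esub> a, a] w)"

definition quad_relations ::
    "('a, 'm) monoid_scheme \<Rightarrow> 'a set \<Rightarrow> ('a list \<Rightarrow> 'k::field) set" where
  "quad_relations G C = {x \<in> tensor_deg C 2. (\<lambda>w. x w - braiding G C x w) = (\<lambda>w. 0)}"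

definition quad_ideal ::
    "('a, 'm) monoid_scheme \<Rightarrow> 'a set \<Rightarrow> ('a list \<Rightarrow> 'k::field) set" where
  "quad_ideal G C = Idl\<^bsub>tensor_alg C\<^esub> (quad_relations G C)"

definition Lambda_quad ::
    "('a, 'm) monoid_scheme \<Rightarrow> 'a set \<Rightarrow> ('a list \<Rightarrow> 'k::field) set ring" where
  "Lambda_quad G C = tensor_alg C Quot quad_ideal G C"

definition quad_class ::
    "('a, 'm) monoid_scheme \<Rightarrow> 'a set \<Rightarrow> ('a list \<Rightarrow> 'k::field) \<Rightarrow> ('a list \<Rightarrow> 'k) set" where
  "quad_class G C x = quad_ideal G C +>\<^bsub>tensor_alg C\<^esub> x"

text \<open>
  Since \<open>\<Psi>\<close> preserves the product \<open>a\<^sub>1 \<cdots> a\<^sub>n\<close> of a word, \<open>\<Lambda>\<^sub>q\<^sub>u\<^sub>a\<^sub>d\<close> is \<open>G\<close>-graded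
  with \<open>e\<^sub>a\<close> of degree \<open>a\<close>.  The projection to degree \<open>h\<close> is first defined on tensors and then on
  classes, where the union is over representatives, which all give the same class.
\<close>

definition tensor_gcomp ::
    "('a, 'm) monoid_scheme \<Rightarrow> 'a \<Rightarrow> ('a list \<Rightarrow> 'k::field) \<Rightarrow> 'a list \<Rightarrow> 'k" where
  "tensor_gcomp G h x = (\<lambda>w. if foldr (\<otimes>\<^bsub>G\<^esub>) w \<one>\<^bsub>G\<^esub> = h then x w else 0)"

definition quad_gcomp ::
    "('a, 'm) monoid_scheme \<Rightarrow> 'a set \<Rightarrow> 'a \<Rightarrow> ('a list \<Rightarrow> 'k::field) set \<Rightarrow> ('a list \<Rightarrow> 'k) set" where
  "quad_gcomp G C h A = (\<Union>x\<in>A. quad_class G C (tensor_gcomp G h x))"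

definition right_translate ::
    "('a, 'm) monoid_scheme \<Rightarrow> 'a \<Rightarrow> ('a \<Rightarrow> 'b) \<Rightarrow> 'a \<Rightarrow> 'b" where
  "right_translate G a f = (\<lambda>g\<in>carrier G. f (g \<otimes>\<^bsub>G\<^esub> a))"

text \<open>
  The exterior algebra \<open>\<Omega> = k(G) \<otimes> \<Lambda>\<^sub>q\<^sub>u\<^sub>a\<^sub>d\<close>, with \<open>f \<otimes> \<lambda>\<close> identified with the
  function \<open>g \<mapsto> f(g) \<lambda>\<close> from \<open>G\<close> to \<open>\<Lambda>\<^sub>q\<^sub>u\<^sub>a\<^sub>d\<close> (a bijection as \<open>G\<close> is finite).
  The cross relations \<open>e\<^sub>a f = R\<^sub>a(f) e\<^sub>a\<close> give \<open>\<lambda> f = R\<^sub>h(f) \<lambda>\<close> for \<open>\<lambda>\<close> of \<open>G\<close>-degree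
  \<open>h\<close>, because \<open>R\<^sub>a R\<^sub>b = R\<^bsub>ab\<^esub>\<close>.  Hence the product is
  \<open>(f \<otimes> \<lambda>) (f' \<otimes> \<lambda>') = \<Sum>\<^sub>h f R\<^sub>h(f') \<otimes> \<lambda>\<^sub>h \<lambda>'\<close>, where \<open>\<lambda>\<^sub>h\<close> is the
  component of \<open>\<lambda>\<close> of \<open>G\<close>-degree \<open>h\<close>.
\<close>

type_synonym ('a, 'k) form = "'a \<Rightarrow> ('a list \<Rightarrow> 'k) set"

definition ext_alg ::
    "('a, 'm) monoid_scheme \<Rightarrow> 'a set \<Rightarrow> ('a, 'k::field) form ring" where
  "ext_alg G C =
    \<lparr> carrier = carrier G \<rightarrow>\<^sub>E carrier (Lambda_quad G C),
      monoid.mult = (\<lambda>\<omega> \<eta>. \<lambda>g\<in>carrier G.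
        \<Oplus>\<^bsub>Lambda_quad G C\<^esub> h\<in>carrier G.
          quad_gcomp G C h (\<omega> g) \<otimes>\<^bsub>Lambda_quad G C\<^esub> right_translate G h \<eta> g),
      one = (\<lambda>g\<in>carrier G. \<one>\<^bsub>Lambda_quad G C\<^esub>),
      ring.zero = (\<lambda>g\<in>carrier G. \<zero>\<^bsub>Lambda_quad G C\<^esub>),
      ring.add = (\<lambda>\<omega> \<eta>. \<lambda>g\<in>carrier G. \<omega> g \<oplus>\<^bsub>Lambda_quad G C\<^esub> \<eta> g) \<rparr>"

definition form_deg ::
    "('a, 'm) monoid_scheme \<Rightarrow> 'a set \<Rightarrow> nat \<Rightarrow> ('a, 'k::field) form set" where
  "form_deg G C n = carrier G \<rightarrow>\<^sub>E quad_class G C ` tensor_deg C n"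

definition const_form ::
    "('a, 'm) monoid_scheme \<Rightarrow> 'a set \<Rightarrow> ('a list \<Rightarrow> 'k::field) \<Rightarrow> ('a, 'k) form" where
  "const_form G C x = (\<lambda>g\<in>carrier G. quad_class G C x)"

definition e_form ::
    "('a, 'm) monoid_scheme \<Rightarrow> 'a set \<Rightarrow> 'a \<Rightarrow> ('a, 'k::field) form" where
  "e_form G C a = const_form G C (word_tensor [a])"

definition theta_form ::
    "('a, 'm) monoid_scheme \<Rightarrow> 'a set \<Rightarrow> ('a, 'k::field) form" where
  "theta_form G C = (\<Oplus>\<^bsub>ext_alg G C\<^esub> a\<in>C. e_form G C a)"

text \<open>The differential is \<open>d : \<Omega>\<^sup>n \<rightarrow> \<Omega>\<^sup>n\<^sup>+\<^sup>1\<close>; \<open>n\<close> is the degree of the argument.\<close>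

definition ext_diff ::
    "('a, 'm) monoid_scheme \<Rightarrow> 'a set \<Rightarrow> nat \<Rightarrow> ('a, 'k::field) form \<Rightarrow> ('a, 'k) form" where
  "ext_diff G C n \<omega> =
    theta_form G C \<otimes>\<^bsub>ext_alg G C\<^esub> \<omega>
      \<ominus>\<^bsub>ext_alg G C\<^esub> (\<ominus>\<^bsub>ext_alg G C\<^esub> \<one>\<^bsub>ext_alg G C\<^esub>) [^]\<^bsub>ext_alg G C\<^esub> n
        \<otimes>\<^bsub>ext_alg G C\<^esub> (\<omega> \<otimes>\<^bsub>ext_alg G C\<^esub> theta_form G C)"

definition connection ::
    "('a, 'm) monoid_scheme \<Rightarrow> 'a set \<Rightarrow> ('a, 'k::field) form \<Rightarrow> bool" where
  "connection G C \<alpha> \<longleftrightarrow> \<alpha> \<in> form_deg G C 1"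

definition curvature ::
    "('a, 'm) monoid_scheme \<Rightarrow> 'a set \<Rightarrow> ('a, 'k::field) form \<Rightarrow> ('a, 'k) form" where
  "curvature G C \<alpha> =
    ext_diff G C 1 \<alpha> \<oplus>\<^bsub>ext_alg G C\<^esub> \<alpha> [^]\<^bsub>ext_alg G C\<^esub> (2::nat)"

definition flat_connection ::
    "('a, 'm) monoid_scheme \<Rightarrow> 'a set \<Rightarrow> ('a, 'k::field) form \<Rightarrow> bool" where
  "flat_connection G C \<alpha> \<longleftrightarrow> connection G C \<alpha> \<and> curvature G C \<alpha> = \<zero>\<^bsub>ext_alg G C\<^esub>"

definition constant_coeffs ::
    "('a, 'm) monoid_scheme \<Rightarrow> 'a set \<Rightarrow> ('a, 'k::field) form \<Rightarrow> bool" where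
  "constant_coeffs G C \<alpha> \<longleftrightarrow> \<alpha> \<in> const_form G C ` tensor_deg C 1"

definition two_cycles :: "nat \<Rightarrow> (nat \<Rightarrow> nat) set" where
  "two_cycles N = {transpose i j | i j. i \<in> {1..N} \<and> j \<in> {1..N} \<and> i \<noteq> j}"

abbreviation Omega_S :: "nat \<Rightarrow> (nat \<Rightarrow> nat, 'k::field) form ring" where
  "Omega_S N \<equiv> ext_alg (sym_group N) (two_cycles N)"

definition theta_S :: "nat \<Rightarrow> nat \<Rightarrow> (nat \<Rightarrow> nat, 'k::field) form" where
  "theta_S N i =
    (\<Oplus>\<^bsub>Omega_S N\<^esub> j\<in>{1..N} - {i}. e_form (sym_group N) (two_cycles N) (transpose i j))"

definition alpha_S :: "nat \<Rightarrow> nat \<Rightarrow> (nat \<Rightarrow> nat, 'k::field) form" where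
  "alpha_S N i = \<ominus>\<^bsub>Omega_S N\<^esub> theta_S N i"

end

theory Submission
  imports Defs
begin

text \<open>
  The quadratic ideal is homogeneous for the \<open>G\<close>-grading of the tensor algebra, so constant
  coefficient forms multiply as tensors do modulo the ideal.  The tensor
  \<open>\<Sum>\<^sub>a\<^sub>,\<^sub>b f(a, b) e\<^sub>a \<otimes> e\<^sub>b\<close> is a relation as soon as \<open>f\<close> is invariant under
  \<open>(a, b) \<mapsto> (aba\<^sup>-\<^sup>1, a)\<close>.  Now \<open>F(\<alpha>\<^sub>i) = -(\<theta>\<theta>\<^sub>i + \<theta>\<^sub>i\<theta> - \<theta>\<^sub>i\<^sup>2)\<close> is minus the sum of
  \<open>e\<^sub>a e\<^sub>b\<close> over the pairs in which \<open>a\<close> or \<open>b\<close> moves \<open>i\<close>, a condition that depends only on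
  the subgroup generated by \<open>a\<close> and \<open>b\<close>, hence is invariant.  For \<open>\<theta>\<^sub>i\<theta>\<^sub>j + \<theta>\<^sub>j\<theta>\<^sub>i\<close> the
  invariance follows from the fact that a 2-cycle moving both \<open>i\<close> and \<open>j\<close> exchanges them.
\<close>

section \<open>The tensor algebra is a ring\<close>

lemma tensor_alg_simps:
  "carrier (tensor_alg C) = {x. finite {w. x w \<noteq> 0} \<and> {w. x w \<noteq> 0} \<subseteq> lists C}"
  "\<one>\<^bsub>tensor_alg C\<^esub> = word_tensor []"
  "\<zero>\<^bsub>tensor_alg C\<^esub> = (\<lambda>w. 0)"
  "x \<oplus>\<^bsub>tensor_alg C\<^esub> y = (\<lambda>w. x w + y w)"
  by (simp_all add: tensor_alg_def)

lemma tensor_carrierI: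
  assumes "finite S" "S \<subseteq> lists C" "\<And>w. x w \<noteq> 0 \<Longrightarrow> w \<in> S"
  shows "x \<in> carrier (tensor_alg C)"
proof -
  have "{w. x w \<noteq> 0} \<subseteq> S" using assms(3) by auto
  then show ?thesis
    using assms(1,2) finite_subset[of "{w. x w \<noteq> 0}" S] by (auto simp: tensor_alg_simps)
qed

lemma tensor_supportD: "\<lbrakk>x \<in> carrier (tensor_alg C); x w \<noteq> 0\<rbrakk> \<Longrightarrow> set w \<subseteq> C"
  by (auto simp: tensor_alg_simps)

text \<open>A factorisation \<open>u @ v = w\<close> is determined by the length of
  \<open>u\<close>, so the convolution becomes a finite sum over cut positions, whatever the
  supports of \<open>x\<close> and \<open>y\<close>.\<close>

lemma tensor_mult_eq_sum:
  "(x \<otimes>\<^bsub>tensor_alg C\<^esub> y) w = (\<Sum>i\<le>length w. x (take i w) * y (drop i w))"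
proof -
  have "bij_betw (\<lambda>i. (take i w, drop i w)) {..length w} {(u, v). u @ v = w}"
    by (rule bij_betwI[where g = "\<lambda>(u, v). length u"]) auto
  from sum.reindex_bij_betw[OF this, of "\<lambda>(u, v). x u * y v"] show ?thesis
    by (simp add: tensor_alg_def)
qed

lemma tensor_mult_Nil: "(x \<otimes>\<^bsub>tensor_alg C\<^esub> y) [] = x [] * y []"
  by (simp add: tensor_mult_eq_sum)

text \<open>The cut at position 0 gives the first term; every other cut keeps \<open>a\<close> in
  the left factor. This is the recursion on words behind associativity and the unit laws.\<close>

lemma tensor_mult_Cons:
  "(x \<otimes>\<^bsub>tensor_alg C\<^esub> y) (a # w) = x [] * y (a # w) + ((\<lambda>u. x (a # u)) \<otimes>\<^bsub>tensor_alg C\<^esub> y) w"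
  by (simp add: tensor_mult_eq_sum sum.atMost_Suc_shift del: sum.atMost_Suc)

lemma tensor_mult_scaled_add:
  "((\<lambda>u. c * x u + y u) \<otimes>\<^bsub>tensor_alg C\<^esub> z) w
     = c * (x \<otimes>\<^bsub>tensor_alg C\<^esub> z) w + (y \<otimes>\<^bsub>tensor_alg C\<^esub> z) w"
  by (simp add: tensor_mult_eq_sum algebra_simps sum.distrib sum_distrib_left)

text \<open>The induction generalises \<open>x\<close> because the recursion replaces it by its
  shift \<open>\<lambda>u. x (a # u)\<close>. The shift of a product is a scalar multiple plus a
  product, which \<open>tensor_mult_scaled_add\<close> expands.\<close>

lemma tensor_mult_assoc:
  "((x \<otimes>\<^bsub>tensor_alg C\<^esub> y) \<otimes>\<^bsub>tensor_alg C\<^esub> z) w = (x \<otimes>\<^bsub>tensor_alg C\<^esub> (y \<otimes>\<^bsub>tensor_alg C\<^esub> z)) w"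
  by (induction w arbitrary: x)
    (simp_all add: tensor_mult_Nil tensor_mult_Cons tensor_mult_scaled_add algebra_simps)

lemma tensor_mult_one_left: "(word_tensor [] \<otimes>\<^bsub>tensor_alg C\<^esub> x) w = x w"
proof (cases w)
  case (Cons a v)
  have "(\<lambda>u. word_tensor [] (a # u)) = (\<lambda>u. 0)"
    by (simp add: word_tensor_def)
  with Cons show ?thesis
    by (simp only: tensor_mult_Cons) (simp add: word_tensor_def tensor_mult_eq_sum)
qed (simp add: tensor_mult_Nil word_tensor_def)

lemma tensor_mult_one_right: "(x \<otimes>\<^bsub>tensor_alg C\<^esub> word_tensor []) w = x w"
  by (induction w arbitrary: x) (simp_all add: tensor_mult_Nil tensor_mult_Cons word_tensor_def)

lemma tensor_mult_closed:
  assumes "x \<in> carrier (tensor_alg C)" "y \<in> carrier (tensor_alg C)"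
  shows "x \<otimes>\<^bsub>tensor_alg C\<^esub> y \<in> carrier (tensor_alg C)"
proof (rule tensor_carrierI)
  show "finite ((\<lambda>(u, v). u @ v) ` ({u. x u \<noteq> 0} \<times> {v. y v \<noteq> 0}))"
    using assms by (simp add: tensor_alg_simps)
  show "(\<lambda>(u, v). u @ v) ` ({u. x u \<noteq> 0} \<times> {v. y v \<noteq> 0}) \<subseteq> lists C"
    by (auto dest!: tensor_supportD[OF assms(1)] tensor_supportD[OF assms(2)])
  fix w assume "(x \<otimes>\<^bsub>tensor_alg C\<^esub> y) w \<noteq> 0"
  then obtain i where "x (take i w) * y (drop i w) \<noteq> 0"
    unfolding tensor_mult_eq_sum by (rule sum.not_neutral_contains_not_neutral)
  then show "w \<in> (\<lambda>(u, v). u @ v) ` ({u. x u \<noteq> 0} \<times> {v. y v \<noteq> 0})"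
    by (intro image_eqI[where x = "(take i w, drop i w)"]) auto
qed

lemma tensor_add_closed:
  assumes "x \<in> carrier (tensor_alg C)" "y \<in> carrier (tensor_alg C)"
  shows "(\<lambda>w. x w + y w) \<in> carrier (tensor_alg C)"
  by (rule tensor_carrierI[where S = "{w. x w \<noteq> 0} \<union> {w. y w \<noteq> 0}"])
    (use assms in \<open>auto simp: tensor_alg_simps(1)\<close>)

lemma tensor_uminus_closed:
  "x \<in> carrier (tensor_alg C) \<Longrightarrow> (\<lambda>w. - x w) \<in> carrier (tensor_alg C)"
  by (simp add: tensor_alg_simps(1))

lemma word_tensor_closed: "set u \<subseteq> C \<Longrightarrow> word_tensor u \<in> carrier (tensor_alg C)"
  by (rule tensor_carrierI[where S = "{u}"]) (auto simp: word_tensor_def split: if_splits)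

lemma tensor_alg_ring: "ring (tensor_alg C :: ('a list \<Rightarrow> 'k::field) ring)"
proof (rule ringI)
  show "abelian_group (tensor_alg C :: ('a list \<Rightarrow> 'k) ring)"
  proof (rule abelian_groupI)
    fix x :: "'a list \<Rightarrow> 'k" assume "x \<in> carrier (tensor_alg C)"
    then show "\<exists>y\<in>carrier (tensor_alg C). y \<oplus>\<^bsub>tensor_alg C\<^esub> x = \<zero>\<^bsub>tensor_alg C\<^esub>"
      by (intro bexI[OF _ tensor_uminus_closed]) (auto simp: tensor_alg_simps)
  next
    show "\<zero>\<^bsub>tensor_alg C\<^esub> \<in> carrier (tensor_alg C :: ('a list \<Rightarrow> 'k) ring)"
      by (simp add: tensor_alg_simps)
  qed (simp_all add: tensor_alg_simps(3,4) tensor_add_closed algebra_simps)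
  show "monoid (tensor_alg C :: ('a list \<Rightarrow> 'k) ring)"
    by (rule monoidI)
      (auto simp: tensor_alg_simps(2) tensor_mult_closed word_tensor_closed
        tensor_mult_assoc tensor_mult_one_left tensor_mult_one_right)
qed (simp_all add: tensor_alg_simps(4) fun_eq_iff tensor_mult_eq_sum algebra_simps sum.distrib)

interpretation tensor: ring "tensor_alg C :: ('a list \<Rightarrow> 'k::field) ring" for C
  by (rule tensor_alg_ring)

lemma tensor_uminus:
  "x \<in> carrier (tensor_alg C) \<Longrightarrow> \<ominus>\<^bsub>tensor_alg C\<^esub> x = (\<lambda>w. - x w)"
  by (rule tensor.minus_equality) (auto simp: tensor_alg_simps)

lemma tensor_finsum:
  assumes "finite A" "\<And>i. i \<in> A \<Longrightarrow> f i \<in> carrier (tensor_alg C)"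
  shows "(\<Oplus>\<^bsub>tensor_alg C\<^esub> i\<in>A. f i) = (\<lambda>w. \<Sum>i\<in>A. f i w)"
  using assms by (induction A rule: finite_induct) (auto simp: tensor.finsum_insert Pi_def tensor_alg_simps(3,4))

section \<open>The group grading of the tensor algebra\<close>

lemma tensor_gcomp_closed:
  "x \<in> carrier (tensor_alg C) \<Longrightarrow> tensor_gcomp G h x \<in> carrier (tensor_alg C)"
  by (rule tensor_carrierI[where S = "{w. x w \<noteq> 0}"])
    (auto simp: tensor_alg_simps tensor_gcomp_def split: if_splits)

lemma tensor_gcomp_add:
  "tensor_gcomp G h (\<lambda>w. x w + y w) = (\<lambda>w. tensor_gcomp G h x w + tensor_gcomp G h y w)"
  by (simp add: tensor_gcomp_def fun_eq_iff)

lemma tensor_gcomp_uminus: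
  "tensor_gcomp G h (\<lambda>w. - x w) = (\<lambda>w. - tensor_gcomp G h x w)"
  by (simp add: tensor_gcomp_def fun_eq_iff)

locale finite_conj_set = group G for G (structure) +
  fixes C :: "'a set"
  assumes finite_carrier: "finite (carrier G)"
    and C_subset: "C \<subseteq> carrier G"
    and conj_closed: "\<lbrakk>g \<in> carrier G; a \<in> C\<rbrakk> \<Longrightarrow> g \<otimes> a \<otimes> inv g \<in> C"
begin

abbreviation "wprod w \<equiv> foldr (\<otimes>) w \<one>"

lemma finite_C: "finite C"
  using finite_carrier C_subset finite_subset by blast

lemma C_carrier: "a \<in> C \<Longrightarrow> a \<in> carrier G"
  using C_subset by blast

lemma wprod_closed: "set w \<subseteq> carrier G \<Longrightarrow> wprod w \<in> carrier G"
  by (induction w) auto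

lemma wprod_append:
  "set u \<subseteq> carrier G \<Longrightarrow> set v \<subseteq> carrier G \<Longrightarrow> wprod (u @ v) = wprod u \<otimes> wprod v"
  by (induction u) (auto simp: wprod_closed m_assoc)

text \<open>For a cut of \<open>w\<close> into \<open>u\<close> and \<open>v\<close>, only
  \<open>k = wprod u\<close> can contribute, and then \<open>v\<close> has degree
  \<open>inv k \<otimes> h\<close> exactly when the whole word has degree \<open>h\<close>.\<close>

lemma tensor_gcomp_mult:
  assumes x: "x \<in> carrier (tensor_alg C)" and y: "y \<in> carrier (tensor_alg C)" and h: "h \<in> carrier G"
  shows "tensor_gcomp G h (x \<otimes>\<^bsub>tensor_alg C\<^esub> y) =
    (\<lambda>w. \<Sum>k\<in>carrier G. (tensor_gcomp G k x \<otimes>\<^bsub>tensor_alg C\<^esub> tensor_gcomp G (inv k \<otimes> h) y) w)"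
proof
  fix w
  have *: "(\<Sum>k\<in>carrier G. tensor_gcomp G k x u * tensor_gcomp G (inv k \<otimes> h) y v)
      = (if wprod (u @ v) = h then x u * y v else 0)" for u v
  \<comment> \<open>Only words in the supports are known to have letters in the group, which the
    group laws for \<open>wprod\<close> require.\<close>
  proof (cases "x u = 0 \<or> y v = 0")
    case False
    then have "set u \<subseteq> carrier G" "set v \<subseteq> carrier G"
      using x y C_subset tensor_supportD by blast+
    moreover from this have "wprod v = inv wprod u \<otimes> h \<longleftrightarrow> wprod u \<otimes> wprod v = h"
      using h by (metis inv_solve_left' wprod_closed)
    moreover have "(\<Sum>k\<in>carrier G. tensor_gcomp G k x u * tensor_gcomp G (inv k \<otimes> h) y v)
        = (\<Sum>k\<in>carrier G. if k = wprod u then x u * tensor_gcomp G (inv k \<otimes> h) y v else 0)"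
      by (rule sum.cong) (auto simp: tensor_gcomp_def)
    ultimately show ?thesis
      using finite_carrier by (simp add: sum.delta wprod_closed wprod_append tensor_gcomp_def del: foldr_append)
  next
    case True
    then have "tensor_gcomp G k x u * tensor_gcomp G (inv k \<otimes> h) y v = 0" for k
      by (auto simp: tensor_gcomp_def)
    then have "(\<Sum>k\<in>carrier G. tensor_gcomp G k x u * tensor_gcomp G (inv k \<otimes> h) y v) = 0"
      by (intro sum.neutral) blast
    with True show ?thesis by auto
  qed
  have "(\<Sum>k\<in>carrier G. (tensor_gcomp G k x \<otimes>\<^bsub>tensor_alg C\<^esub> tensor_gcomp G (inv k \<otimes> h) y) w)
      = (\<Sum>i\<le>length w. \<Sum>k\<in>carrier G. tensor_gcomp G k x (take i w) * tensor_gcomp G (inv k \<otimes> h) y (drop i w))"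
    by (simp only: tensor_mult_eq_sum) (rule sum.swap)
  also have "\<dots> = tensor_gcomp G h (x \<otimes>\<^bsub>tensor_alg C\<^esub> y) w"
    by (simp add: * del: foldr_append) (simp add: tensor_gcomp_def tensor_mult_eq_sum)
  finally show "tensor_gcomp G h (x \<otimes>\<^bsub>tensor_alg C\<^esub> y) w =
    (\<Sum>k\<in>carrier G. (tensor_gcomp G k x \<otimes>\<^bsub>tensor_alg C\<^esub> tensor_gcomp G (inv k \<otimes> h) y) w)" by simp
qed

lemma sum_tensor_gcomp:
  assumes "x \<in> carrier (tensor_alg C)"
  shows "(\<lambda>w. \<Sum>h\<in>carrier G. tensor_gcomp G h x w) = x"
proof
  fix w
  show "(\<Sum>h\<in>carrier G. tensor_gcomp G h x w) = x w"
  proof (cases "x w = 0")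
    case False
    then have "wprod w \<in> carrier G"
      using assms C_subset by (intro wprod_closed) (use tensor_supportD in blast)
    then show ?thesis
      using finite_carrier by (simp add: tensor_gcomp_def sum.delta')
  next
    case True
    then have "tensor_gcomp G h x w = 0" for h
      by (simp add: tensor_gcomp_def)
    with True show ?thesis by simp
  qed
qed

section \<open>The braiding, and homogeneity of the quadratic ideal\<close>

lemma braiding_apply:
  fixes x :: "'a list \<Rightarrow> 'k::field"
  shows "braiding G C x w =
    (case w of [c, d] \<Rightarrow> if c \<in> C \<and> d \<in> C then x [d, inv d \<otimes> c \<otimes> d] else 0 | _ \<Rightarrow> 0)"
proof (cases "\<exists>c d. w = [c, d]")
  case True
  then obtain c d where w: "w = [c, d]" by blast
  \<comment> \<open>The map \<open>(a, b)\<close> to \<open>(a b inv a, a)\<close> is a bijection of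
    pairs in \<open>C\<close> with inverse \<open>(c, d)\<close> to \<open>(d, inv d c d)\<close>,
    so at most one term of the double sum survives. The conjunct on \<open>c\<close> allows
    cancellation in the group and accounts for the value 0 when \<open>c\<close> is outside
    \<open>C\<close>.\<close>
  have iff: "c = a \<otimes> b \<otimes> inv a \<longleftrightarrow> b = inv a \<otimes> c \<otimes> a \<and> c \<in> C" if "a \<in> C" "b \<in> C" for a b
    using that conj_closed[of a b] C_carrier
    by (smt (verit) inv_closed inv_solve_left inv_solve_right m_assoc m_closed)
  have mem: "inv d \<otimes> c \<otimes> d \<in> C" if "c \<in> C" "d \<in> C"
    using conj_closed[of "inv d" c] that C_carrier by simp
  have "braiding G C x w = (\<Sum>a\<in>C. if a = d then
      \<Sum>b\<in>C. if b = inv d \<otimes> c \<otimes> d then if c \<in> C then x [d, b] else 0 else 0 else 0)"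
    unfolding braiding_def word_tensor_def w
    by (intro sum.cong refl) (auto simp: iff intro!: sum.cong sum.neutral)
  also have "\<dots> = (if c \<in> C \<and> d \<in> C then x [d, inv d \<otimes> c \<otimes> d] else 0)"
    using mem by (auto simp: finite_C)
  finally show ?thesis by (simp add: w)
next
  case False
  then have "word_tensor [a \<otimes> b \<otimes> inv a, a] w = (0::'k)" for a b
    by (auto simp: word_tensor_def)
  then have "braiding G C x w = 0"
    by (simp add: braiding_def)
  with False show ?thesis
    by (auto split: list.split)
qed

lemma quad_relations_subset: "quad_relations G C \<subseteq> carrier (tensor_alg C)"
  by (auto simp: quad_relations_def tensor_deg_def)

lemma quad_ideal_ideal: "ideal (quad_ideal G C) (tensor_alg C)"
  unfolding quad_ideal_def by (rule tensor.genideal_ideal[OF quad_relations_subset])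

text \<open>The braiding preserves the product of a word, as \<open>d (inv d c d) = c d\<close>. It
  therefore commutes with the projection to degree \<open>h\<close>, which maps its fixed tensors to
  fixed tensors.\<close>

lemma quad_relations_gcomp:
  assumes "x \<in> quad_relations G C"
  shows "tensor_gcomp G h x \<in> quad_relations G C"
proof -
  have "tensor_gcomp G h x \<in> tensor_deg C 2"
    using assms tensor_gcomp_closed[of x C G h]
    by (auto simp: quad_relations_def tensor_deg_def) (auto simp: tensor_gcomp_def split: if_splits)
  moreover have "braiding G C (tensor_gcomp G h x) w = tensor_gcomp G h (braiding G C x) w" for w
  proof -
    have "d \<otimes> (inv d \<otimes> c \<otimes> d) = c \<otimes> d" if "c \<in> C" "d \<in> C" for c d
      using that C_carrier by (simp add: m_assoc[symmetric])
    then show ?thesis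
      by (auto simp: braiding_apply tensor_gcomp_def C_carrier split: list.split)
  qed
  moreover have "x w = braiding G C x w" for w
    using assms by (simp add: quad_relations_def fun_eq_iff)
  ultimately show ?thesis
    by (simp add: quad_relations_def tensor_gcomp_def fun_eq_iff)
qed

text \<open>The tensors all of whose components lie in the quadratic ideal form an ideal
  \<open>J\<close> that contains the relations; minimality of the generated ideal does the
  rest.\<close>

lemma quad_ideal_gcomp:
  fixes x :: "'a list \<Rightarrow> 'k::field"
  assumes "x \<in> quad_ideal G C" "h \<in> carrier G"
  shows "tensor_gcomp G h x \<in> quad_ideal G C"
proof -
  let ?T = "tensor_alg C :: ('a list \<Rightarrow> 'k) ring" and ?I = "quad_ideal G C :: ('a list \<Rightarrow> 'k) set"
  interpret I: ideal ?I ?T by (rule quad_ideal_ideal)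
  define J where "J = {x \<in> carrier ?T. \<forall>h\<in>carrier G. tensor_gcomp G h x \<in> ?I}"
  \<comment> \<open>By \<open>tensor_gcomp_mult\<close>, a component of a product is a pointwise sum
    over \<open>k\<close>. Reading it as a ring sum makes closure of the ideal under addition
    applicable.\<close>
  have sumI: "(\<lambda>w. \<Sum>k\<in>carrier G. f k w) \<in> ?I" if f: "\<And>k. k \<in> carrier G \<Longrightarrow> f k \<in> ?I" for f
  proof -
    have "(\<Oplus>\<^bsub>?T\<^esub> k\<in>A. f k) \<in> ?I" if "finite A" "A \<subseteq> carrier G" for A
      using that
    proof (induction A rule: finite_induct)
      case (insert k A)
      then have "f ` A \<subseteq> carrier ?T" "f k \<in> ?I"
        using f I.Icarr by blast+
      with insert show ?case
        by (simp add: image_subset_iff_funcset tensor.finsum_insert I.Icarr I.a_closed)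
    qed simp
    from this[OF finite_carrier subset_refl] show ?thesis
      by (simp add: tensor_finsum finite_carrier I.Icarr f)
  qed
  have "ideal J ?T"
  proof (rule idealI[OF tensor_alg_ring])
    show "subgroup J (add_monoid ?T)"
    proof (rule tensor.add.subgroupI)
      show "J \<noteq> {}"
        using I.zero_closed by (auto simp: J_def tensor_gcomp_def tensor_alg_simps
            intro!: exI[of _ "\<lambda>w. 0"])
      fix x y assume xy: "x \<in> J" "y \<in> J"
      then show "x \<oplus>\<^bsub>?T\<^esub> y \<in> J"
        using I.a_closed by (auto simp: J_def tensor_alg_simps(4) tensor_gcomp_add tensor_add_closed)
      have "tensor_gcomp G h (\<ominus>\<^bsub>?T\<^esub> x) = \<ominus>\<^bsub>?T\<^esub> tensor_gcomp G h x" for h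
        using xy by (simp add: J_def tensor_uminus tensor_gcomp_closed tensor_gcomp_uminus)
      then show "\<ominus>\<^bsub>?T\<^esub> x \<in> J"
        using xy I.a_inv_closed by (auto simp: J_def)
    qed (auto simp: J_def)
  next
    fix x y assume x: "x \<in> J" and y: "y \<in> carrier ?T"
    have xI: "tensor_gcomp G k x \<in> ?I" if "k \<in> carrier G" for k
      using x that by (simp add: J_def)
    have x': "x \<in> carrier ?T"
      using x by (simp add: J_def)
    show "y \<otimes>\<^bsub>?T\<^esub> x \<in> J"
      using x' y xI by (auto simp: J_def tensor_mult_closed tensor_gcomp_mult tensor_gcomp_closed
          intro!: sumI I.I_l_closed)
    show "x \<otimes>\<^bsub>?T\<^esub> y \<in> J"
      using x' y xI by (auto simp: J_def tensor_mult_closed tensor_gcomp_mult tensor_gcomp_closed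
          intro!: sumI I.I_r_closed)
  qed
  moreover have "quad_relations G C \<subseteq> J"
    using quad_relations_gcomp tensor.genideal_self[OF quad_relations_subset] quad_relations_subset
    by (auto simp: J_def quad_ideal_def)
  ultimately have "?I \<subseteq> J"
    unfolding quad_ideal_def by (rule tensor.genideal_minimal)
  with assms show ?thesis by (auto simp: J_def)
qed

section \<open>The quadratic algebra as a graded quotient\<close>

lemma Lambda_quad_ring: "ring (Lambda_quad G C)"
  unfolding Lambda_quad_def by (rule ideal.quotient_is_ring[OF quad_ideal_ideal])

lemma quad_class_hom: "quad_class G C \<in> ring_hom (tensor_alg C) (Lambda_quad G C)"
  using ideal.rcos_ring_hom[OF quad_ideal_ideal]
  by (simp add: quad_class_def[abs_def] Lambda_quad_def)

lemma quad_class_eq_zero: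
  "x \<in> quad_ideal G C \<Longrightarrow> quad_class G C x = \<zero>\<^bsub>Lambda_quad G C\<^esub>"
  using tensor.a_rcos_zero[OF quad_ideal_ideal]
  by (simp add: quad_class_def Lambda_quad_def FactRing_def)

text \<open>Two representatives differ by an element of the ideal, whose component stays in the
  ideal. The union defining \<open>quad_gcomp\<close> thus runs over copies of one class, and it is
  not empty since \<open>x\<close> is itself a representative.\<close>

lemma quad_gcomp_class:
  fixes x :: "'a list \<Rightarrow> 'k::field"
  assumes x: "x \<in> carrier (tensor_alg C)" and h: "h \<in> carrier G"
  shows "quad_gcomp G C h (quad_class G C x) = quad_class G C (tensor_gcomp G h x)"
proof -
  let ?T = "tensor_alg C :: ('a list \<Rightarrow> 'k) ring" and ?L = "Lambda_quad G C :: ('a list \<Rightarrow> 'k) set ring"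
  interpret I: ideal "quad_ideal G C" ?T by (rule quad_ideal_ideal)
  interpret L: ring ?L by (rule Lambda_quad_ring)
  have "quad_class G C (tensor_gcomp G h y) = quad_class G C (tensor_gcomp G h x)"
    if yx: "y \<in> quad_class G C x" for y
  proof -
    obtain i where i: "i \<in> quad_ideal G C" and y: "y = i \<oplus>\<^bsub>?T\<^esub> x"
      using yx by (auto simp: quad_class_def a_r_coset_def')
    have "tensor_gcomp G h y = tensor_gcomp G h i \<oplus>\<^bsub>?T\<^esub> tensor_gcomp G h x"
      by (simp add: y tensor_alg_simps(4) tensor_gcomp_add)
    then show ?thesis
      using quad_ideal_gcomp[OF i h] tensor_gcomp_closed[OF x, of G h] I.Icarr
      by (simp add: ring_hom_add[OF quad_class_hom] ring_hom_closed[OF quad_class_hom] quad_class_eq_zero)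
  qed
  moreover have "x \<in> quad_class G C x"
    unfolding quad_class_def using x by (rule I.a_rcos_self)
  ultimately show ?thesis
    unfolding quad_gcomp_def by blast
qed

section \<open>The exterior algebra and its constant forms\<close>

lemma ext_alg_add_simps:
  "carrier (ext_alg G C) = carrier G \<rightarrow>\<^sub>E carrier (Lambda_quad G C)"
  "\<zero>\<^bsub>ext_alg G C\<^esub> = (\<lambda>g\<in>carrier G. \<zero>\<^bsub>Lambda_quad G C\<^esub>)"
  "\<omega> \<oplus>\<^bsub>ext_alg G C\<^esub> \<eta> = (\<lambda>g\<in>carrier G. \<omega> g \<oplus>\<^bsub>Lambda_quad G C\<^esub> \<eta> g)"
  by (simp_all add: ext_alg_def)

text \<open>The additive laws hold pointwise. Multiplication enters later only between constant
  forms, where \<open>const_form_mult\<close> reduces it to the tensor algebra.\<close>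

lemma ext_alg_abelian_group: "abelian_group (ext_alg G C :: ('a, 'k::field) form ring)"
proof (rule abelian_groupI; unfold ext_alg_add_simps)
  let ?L = "Lambda_quad G C :: ('a list \<Rightarrow> 'k) set ring"
  interpret L: ring ?L by (rule Lambda_quad_ring)
  fix \<omega> \<eta> \<zeta> :: "('a, 'k) form"
  assume \<omega>: "\<omega> \<in> carrier G \<rightarrow>\<^sub>E carrier ?L"
  note \<omega>' = PiE_mem[OF \<omega>]
  have "(\<lambda>g\<in>carrier G. \<ominus>\<^bsub>?L\<^esub> \<omega> g) \<in> carrier G \<rightarrow>\<^sub>E carrier ?L"
    by (simp add: \<omega>')
  moreover have "(\<lambda>g\<in>carrier G. (\<lambda>g\<in>carrier G. \<ominus>\<^bsub>?L\<^esub> \<omega> g) g \<oplus>\<^bsub>?L\<^esub> \<omega> g) = (\<lambda>g\<in>carrier G. \<zero>\<^bsub>?L\<^esub>)"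
    by (rule restrict_ext) (simp add: \<omega>' L.l_neg)
  ultimately show "\<exists>\<eta>\<in>carrier G \<rightarrow>\<^sub>E carrier ?L.
      (\<lambda>g\<in>carrier G. \<eta> g \<oplus>\<^bsub>?L\<^esub> \<omega> g) = (\<lambda>g\<in>carrier G. \<zero>\<^bsub>?L\<^esub>)"
    by blast
  have "(\<lambda>g\<in>carrier G. (\<lambda>g\<in>carrier G. \<zero>\<^bsub>?L\<^esub>) g \<oplus>\<^bsub>?L\<^esub> \<omega> g) = restrict \<omega> (carrier G)"
    by (rule restrict_ext) (simp add: \<omega>')
  then show "(\<lambda>g\<in>carrier G. (\<lambda>g\<in>carrier G. \<zero>\<^bsub>?L\<^esub>) g \<oplus>\<^bsub>?L\<^esub> \<omega> g) = \<omega>"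
    using \<omega> by (simp add: PiE_restrict)
  assume \<eta>: "\<eta> \<in> carrier G \<rightarrow>\<^sub>E carrier ?L"
  note \<eta>' = PiE_mem[OF \<eta>]
  show "(\<lambda>g\<in>carrier G. \<omega> g \<oplus>\<^bsub>?L\<^esub> \<eta> g) \<in> carrier G \<rightarrow>\<^sub>E carrier ?L"
    by (simp add: \<omega>' \<eta>')
  show "(\<lambda>g\<in>carrier G. \<omega> g \<oplus>\<^bsub>?L\<^esub> \<eta> g) = (\<lambda>g\<in>carrier G. \<eta> g \<oplus>\<^bsub>?L\<^esub> \<omega> g)"
    by (rule restrict_ext) (simp add: \<omega>' \<eta>' L.a_comm)
  assume \<zeta>: "\<zeta> \<in> carrier G \<rightarrow>\<^sub>E carrier ?L"
  show "(\<lambda>g\<in>carrier G. (\<lambda>g\<in>carrier G. \<omega> g \<oplus>\<^bsub>?L\<^esub> \<eta> g) g \<oplus>\<^bsub>?L\<^esub> \<zeta> g)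
      = (\<lambda>g\<in>carrier G. \<omega> g \<oplus>\<^bsub>?L\<^esub> (\<lambda>g\<in>carrier G. \<eta> g \<oplus>\<^bsub>?L\<^esub> \<zeta> g) g)"
    by (rule restrict_ext) (simp add: \<omega>' \<eta>' PiE_mem[OF \<zeta>] L.a_assoc)
next
  interpret L: ring "Lambda_quad G C :: ('a list \<Rightarrow> 'k) set ring" by (rule Lambda_quad_ring)
  show "(\<lambda>g\<in>carrier G. \<zero>\<^bsub>Lambda_quad G C\<^esub>) \<in> carrier G \<rightarrow>\<^sub>E carrier (Lambda_quad G C :: ('a list \<Rightarrow> 'k) set ring)"
    by simp
qed

lemma const_form_closed: "x \<in> carrier (tensor_alg C) \<Longrightarrow> const_form G C x \<in> carrier (ext_alg G C)"
  using ring_hom_closed[OF quad_class_hom] by (auto simp: const_form_def ext_alg_def)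

lemma const_form_one: "const_form G C \<one>\<^bsub>tensor_alg C\<^esub> = \<one>\<^bsub>ext_alg G C\<^esub>"
  by (simp add: const_form_def ext_alg_def ring_hom_one[OF quad_class_hom])

lemma const_form_eq_zero:
  "x \<in> quad_ideal G C \<Longrightarrow> const_form G C x = \<zero>\<^bsub>ext_alg G C\<^esub>"
  by (simp add: const_form_def ext_alg_def quad_class_eq_zero)

lemma const_form_add:
  assumes "x \<in> carrier (tensor_alg C)" "y \<in> carrier (tensor_alg C)"
  shows "const_form G C (x \<oplus>\<^bsub>tensor_alg C\<^esub> y) = const_form G C x \<oplus>\<^bsub>ext_alg G C\<^esub> const_form G C y"
  using assms by (auto simp: const_form_def ext_alg_def ring_hom_add[OF quad_class_hom]
      cong: restrict_cong)

lemma const_form_zero: "const_form G C \<zero>\<^bsub>tensor_alg C\<^esub> = \<zero>\<^bsub>ext_alg G C\<^esub>"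
proof -
  interpret I: ideal "quad_ideal G C" "tensor_alg C" by (rule quad_ideal_ideal)
  show ?thesis by (rule const_form_eq_zero) simp
qed

lemma const_form_uminus:
  assumes x: "x \<in> carrier (tensor_alg C)"
  shows "const_form G C (\<ominus>\<^bsub>tensor_alg C\<^esub> x) = \<ominus>\<^bsub>ext_alg G C\<^esub> const_form G C x"
proof -
  interpret E: abelian_group "ext_alg G C" by (rule ext_alg_abelian_group)
  have "const_form G C (\<ominus>\<^bsub>tensor_alg C\<^esub> x) \<oplus>\<^bsub>ext_alg G C\<^esub> const_form G C x = \<zero>\<^bsub>ext_alg G C\<^esub>"
    using x by (simp add: const_form_add[symmetric] tensor.l_neg const_form_zero)
  then show ?thesis
    by (intro E.minus_equality[symmetric]) (simp_all add: const_form_closed x)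
qed

lemma const_form_finsum:
  assumes "finite A" "f \<in> A \<rightarrow> carrier (tensor_alg C)"
  shows "const_form G C (\<Oplus>\<^bsub>tensor_alg C\<^esub> i\<in>A. f i) = (\<Oplus>\<^bsub>ext_alg G C\<^esub> i\<in>A. const_form G C (f i))"
proof -
  interpret E: abelian_group "ext_alg G C" by (rule ext_alg_abelian_group)
  show ?thesis
    using assms
  proof (induction A rule: finite_induct)
    case (insert i A)
    then have "(\<lambda>i. const_form G C (f i)) \<in> A \<rightarrow> carrier (ext_alg G C)"
      using const_form_closed by blast
    with insert show ?case
      by (simp add: tensor.finsum_insert E.finsum_insert const_form_add const_form_closed tensor.finsum_closed)
  qed (simp add: const_form_zero)
qed

text \<open>Right translation does not change a constant form, so at each point the product is the
  sum over \<open>h\<close> of the degree \<open>h\<close> part of \<open>x\<close> times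
  \<open>y\<close>, and these parts add up to \<open>x\<close>.\<close>

lemma const_form_mult:
  fixes x :: "'a list \<Rightarrow> 'k::field"
  assumes x: "x \<in> carrier (tensor_alg C)" and y: "y \<in> carrier (tensor_alg C)"
  shows "const_form G C (x \<otimes>\<^bsub>tensor_alg C\<^esub> y) = const_form G C x \<otimes>\<^bsub>ext_alg G C\<^esub> const_form G C y"
proof -
  let ?T = "tensor_alg C :: ('a list \<Rightarrow> 'k) ring" and ?L = "Lambda_quad G C :: ('a list \<Rightarrow> 'k) set ring"
  interpret L: ring ?L by (rule Lambda_quad_ring)
  interpret q: ring_hom_ring ?T ?L "quad_class G C"
    by (rule ring_hom_ringI2[OF tensor_alg_ring Lambda_quad_ring quad_class_hom])
  have comp: "tensor_gcomp G h x \<in> carrier ?T" for h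
    using x by (rule tensor_gcomp_closed)
  have "(\<Oplus>\<^bsub>?T\<^esub> h\<in>carrier G. tensor_gcomp G h x) = x"
    using sum_tensor_gcomp[OF x] by (simp add: tensor_finsum finite_carrier comp)
  then have "quad_class G C (x \<otimes>\<^bsub>?T\<^esub> y)
      = quad_class G C (\<Oplus>\<^bsub>?T\<^esub> h\<in>carrier G. tensor_gcomp G h x \<otimes>\<^bsub>?T\<^esub> y)"
    using tensor.finsum_ldistr[OF finite_carrier y, of "\<lambda>h. tensor_gcomp G h x"] comp by simp
  also have "\<dots> = (\<Oplus>\<^bsub>?L\<^esub> h\<in>carrier G. quad_class G C (tensor_gcomp G h x \<otimes>\<^bsub>?T\<^esub> y))"
    using comp y by (subst q.hom_finsum) (auto simp: comp_def)
  also have "\<dots> = (\<Oplus>\<^bsub>?L\<^esub> h\<in>carrier G.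
      quad_gcomp G C h (quad_class G C x) \<otimes>\<^bsub>?L\<^esub> quad_class G C y)"
    using comp x y by (intro L.finsum_cong') (auto simp: quad_gcomp_class)
  finally have product: "quad_class G C (x \<otimes>\<^bsub>?T\<^esub> y) = \<dots>" .
  show ?thesis
    unfolding const_form_def ext_alg_def monoid.simps
  proof (rule restrict_ext)
    fix g assume g: "g \<in> carrier G"
    show "quad_class G C (x \<otimes>\<^bsub>?T\<^esub> y) = (\<Oplus>\<^bsub>?L\<^esub> h\<in>carrier G.
        quad_gcomp G C h (restrict (\<lambda>g. quad_class G C x) (carrier G) g) \<otimes>\<^bsub>?L\<^esub>
        right_translate G h (restrict (\<lambda>g. quad_class G C y) (carrier G)) g)"
      unfolding product
      using g comp x y by (intro L.finsum_cong') (auto simp: right_translate_def quad_gcomp_class)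
  qed
qed

end

section \<open>Explicit tensors of degree 1 and 2\<close>

definition degree1_tensor :: "'a set \<Rightarrow> 'a list \<Rightarrow> 'k::field" where
  "degree1_tensor D = (\<lambda>w. case w of [a] \<Rightarrow> of_bool (a \<in> D) | _ \<Rightarrow> 0)"

text \<open>The coefficient function \<open>f\<close> may be arbitrary outside \<open>C\<close>; the
  factor \<open>of_bool\<close> keeps the support in words over \<open>C\<close>.\<close>

definition degree2_tensor :: "'a set \<Rightarrow> ('a \<Rightarrow> 'a \<Rightarrow> 'k::field) \<Rightarrow> 'a list \<Rightarrow> 'k" where
  "degree2_tensor C f = (\<lambda>w. case w of [a, b] \<Rightarrow> of_bool (a \<in> C \<and> b \<in> C) * f a b | _ \<Rightarrow> 0)"

lemma degree1_tensor_mult: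
  assumes "D \<subseteq> C" "E \<subseteq> C"
  shows "degree1_tensor D \<otimes>\<^bsub>tensor_alg C\<^esub> degree1_tensor E =
    degree2_tensor C (\<lambda>a b. of_bool (a \<in> D \<and> b \<in> E))"
proof
  fix w
  show "(degree1_tensor D \<otimes>\<^bsub>tensor_alg C\<^esub> degree1_tensor E) w =
    degree2_tensor C (\<lambda>a b. of_bool (a \<in> D \<and> b \<in> E)) w"
  proof (cases w)
    case Nil
    then show ?thesis by (simp add: tensor_mult_Nil degree1_tensor_def degree2_tensor_def)
  next
    case (Cons a v)
    \<comment> \<open>Removing the first letter from a degree 1 tensor leaves a multiple of the
      unit; the summand 0 gives it the shape of \<open>tensor_mult_scaled_add\<close>.\<close>
    have "(\<lambda>u. degree1_tensor D (a # u)) = (\<lambda>u. of_bool (a \<in> D) * word_tensor [] u + 0)"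
      by (auto simp: degree1_tensor_def word_tensor_def fun_eq_iff split: list.split)
    from arg_cong[OF this, of "\<lambda>x. (x \<otimes>\<^bsub>tensor_alg C\<^esub> degree1_tensor E) v"]
    have eq: "((\<lambda>u. degree1_tensor D (a # u)) \<otimes>\<^bsub>tensor_alg C\<^esub> degree1_tensor E) v
        = of_bool (a \<in> D) * degree1_tensor E v"
      by (simp only: tensor_mult_scaled_add tensor_mult_one_left) (simp add: tensor_mult_eq_sum)
    show ?thesis
      unfolding Cons tensor_mult_Cons eq
      using assms by (auto simp: degree1_tensor_def degree2_tensor_def split: list.split)
  qed
qed

lemma degree1_tensor_eq_finsum:
  assumes "finite D" "D \<subseteq> C"
  shows "degree1_tensor D = (\<Oplus>\<^bsub>tensor_alg C\<^esub> a\<in>D. word_tensor [a])"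
proof
  fix w
  have "(\<Oplus>\<^bsub>tensor_alg C\<^esub> a\<in>D. word_tensor [a]) w = (\<Sum>a\<in>D. word_tensor [a] w)"
    using assms by (subst tensor_finsum) (auto intro!: word_tensor_closed)
  also have "\<dots> = degree1_tensor D w"
    \<comment> \<open>The borrowed case rule splits words into empty, one letter, and at least two
      letters.\<close>
    using assms(1) by (cases w rule: remdups_adj.cases)
      (auto simp: word_tensor_def degree1_tensor_def sum.delta sum.delta')
  finally show "degree1_tensor D w = (\<Oplus>\<^bsub>tensor_alg C\<^esub> a\<in>D. word_tensor [a]) w" ..
qed

section \<open>Criteria for flatness and anticommutation\<close>

context finite_conj_set begin

lemma degree1_tensor_deg: "D \<subseteq> C \<Longrightarrow> degree1_tensor D \<in> tensor_deg C 1"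
  unfolding tensor_deg_def
  by (safe intro!: tensor_carrierI[where S = "(\<lambda>a. [a]) ` C"])
    (auto simp: degree1_tensor_def finite_C split: list.splits)

lemma degree1_tensor_closed: "D \<subseteq> C \<Longrightarrow> degree1_tensor D \<in> carrier (tensor_alg C)"
  using degree1_tensor_deg by (auto simp: tensor_deg_def)

text \<open>The braided tensor has at \<open>[c, d]\<close> the coefficient of the unique pair
  braided to \<open>(c, d)\<close>, and by invariance of \<open>f\<close> this is
  \<open>f c d\<close>. The tensor is therefore fixed by the braiding, that is, a relation.\<close>

lemma degree2_tensor_in_quad_ideal:
  assumes f: "\<And>a b. \<lbrakk>a \<in> C; b \<in> C\<rbrakk> \<Longrightarrow> f (a \<otimes> b \<otimes> inv a) a = f a b"
  shows "degree2_tensor C f \<in> quad_ideal G C"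
proof -
  have "degree2_tensor C f \<in> tensor_deg C 2"
    unfolding tensor_deg_def
    by (safe intro!: tensor_carrierI[where S = "(\<lambda>(a, b). [a, b]) ` (C \<times> C)"])
      (auto simp: degree2_tensor_def finite_C split: list.splits)
  moreover have "braiding G C (degree2_tensor C f) w = degree2_tensor C f w" for w
  proof -
    have "inv d \<otimes> c \<otimes> d \<in> C" "f d (inv d \<otimes> c \<otimes> d) = f c d" if "c \<in> C" "d \<in> C" for c d
    proof -
      show mem: "inv d \<otimes> c \<otimes> d \<in> C"
        using conj_closed[of "inv d" c] that C_carrier by simp
      have "d \<otimes> (inv d \<otimes> c \<otimes> d) \<otimes> inv d = c"
        using C_carrier[OF that(1)] C_carrier[OF that(2)]
        by (simp add: m_assoc[symmetric]) (simp add: m_assoc)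
      then show "f d (inv d \<otimes> c \<otimes> d) = f c d"
        using f[OF that(2) mem] by simp
    qed
    then show ?thesis
      by (auto simp: braiding_apply degree2_tensor_def split: list.split)
  qed
  ultimately have "degree2_tensor C f \<in> quad_relations G C"
    by (simp add: quad_relations_def)
  then show ?thesis
    unfolding quad_ideal_def using tensor.genideal_self[OF quad_relations_subset] by blast
qed

lemma const_form_degree1_tensor:
  assumes "D \<subseteq> C"
  shows "const_form G C (degree1_tensor D) = (\<Oplus>\<^bsub>ext_alg G C\<^esub> a\<in>D. e_form G C a)"
proof -
  have "finite D" using assms finite_C finite_subset by blast
  then show ?thesis
    unfolding e_form_def using assms
    by (subst const_form_finsum[symmetric])
      (auto intro!: word_tensor_closed simp: degree1_tensor_eq_finsum[of D C])
qed

text \<open>In degree 1 the sign in \<open>ext_diff\<close> is -1, so the difference becomes the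
  anticommutator with \<theta>. All operations then lift to the tensor algebra.\<close>

lemma curvature_const_form:
  assumes x: "x \<in> carrier (tensor_alg C)"
  defines "\<theta> \<equiv> degree1_tensor C"
  shows "curvature G C (const_form G C x) = const_form G C
    ((\<theta> \<otimes>\<^bsub>tensor_alg C\<^esub> x \<oplus>\<^bsub>tensor_alg C\<^esub> x \<otimes>\<^bsub>tensor_alg C\<^esub> \<theta>) \<oplus>\<^bsub>tensor_alg C\<^esub> x \<otimes>\<^bsub>tensor_alg C\<^esub> x)"
proof -
  interpret E: abelian_group "ext_alg G C" by (rule ext_alg_abelian_group)
  have \<theta>: "\<theta> \<in> carrier (tensor_alg C)"
    unfolding \<theta>_def by (rule degree1_tensor_closed) simp
  have form: "theta_form G C = const_form G C \<theta>"
    by (simp add: theta_form_def \<theta>_def const_form_degree1_tensor)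
  note const_form_hom = const_form_one[symmetric] const_form_uminus[symmetric]
    const_form_mult[symmetric] const_form_add[symmetric]
  show ?thesis
    unfolding curvature_def ext_diff_def a_minus_def form
    using x \<theta> by (simp add: nat_pow_def numeral_2_eq_2 const_form_hom tensor.l_minus)
qed

text \<open>For \<open>a\<close> in \<open>D\<close> the pairs \<open>(a, b)\<close> and
  \<open>(a b inv a, a)\<close> both meet \<open>D\<close>, so invariance is in question only for
  \<open>a\<close> outside \<open>D\<close>. That is the case covered by
  \<open>stable\<close>.\<close>

lemma flat_connection_uminus_degree1:
  assumes D: "D \<subseteq> C"
    and stable: "\<And>a b. \<lbrakk>a \<in> C - D; b \<in> C\<rbrakk> \<Longrightarrow> a \<otimes> b \<otimes> inv a \<in> D \<longleftrightarrow> b \<in> D"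
  defines "\<alpha> \<equiv> \<ominus>\<^bsub>ext_alg G C\<^esub> (\<Oplus>\<^bsub>ext_alg G C\<^esub> a\<in>D. e_form G C a) :: ('a, 'k::field) form"
  shows "flat_connection G C \<alpha>" "constant_coeffs G C \<alpha>"
proof -
  let ?T = "tensor_alg C :: ('a list \<Rightarrow> 'k) ring"
  define t where "t = (degree1_tensor D :: 'a list \<Rightarrow> 'k)"
  define \<theta> where "\<theta> = (degree1_tensor C :: 'a list \<Rightarrow> 'k)"
  have t: "t \<in> carrier ?T" and \<theta>: "\<theta> \<in> carrier ?T"
    unfolding t_def \<theta>_def using D by (auto intro: degree1_tensor_closed)
  have \<alpha>: "\<alpha> = const_form G C (\<ominus>\<^bsub>?T\<^esub> t)"
    using t D by (simp add: \<alpha>_def t_def const_form_uminus const_form_degree1_tensor)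
  have deg: "\<ominus>\<^bsub>?T\<^esub> t \<in> tensor_deg C 1"
  proof -
    have "t \<in> tensor_deg C 1"
      unfolding t_def by (rule degree1_tensor_deg[OF D])
    with t show ?thesis
      by (auto simp: tensor_deg_def tensor_uminus tensor_uminus_closed)
  qed
  then show "constant_coeffs G C \<alpha>"
    by (auto simp: constant_coeffs_def \<alpha>)
  let ?f = "\<lambda>a b. - of_bool (a \<in> D \<or> b \<in> D) :: 'k"
  have "curvature G C \<alpha> = const_form G C (degree2_tensor C ?f)"
  proof -
    have "(\<theta> \<otimes>\<^bsub>?T\<^esub> (\<ominus>\<^bsub>?T\<^esub> t) \<oplus>\<^bsub>?T\<^esub> (\<ominus>\<^bsub>?T\<^esub> t) \<otimes>\<^bsub>?T\<^esub> \<theta>) \<oplus>\<^bsub>?T\<^esub> (\<ominus>\<^bsub>?T\<^esub> t) \<otimes>\<^bsub>?T\<^esub> (\<ominus>\<^bsub>?T\<^esub> t)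
      = (\<lambda>w. - (\<theta> \<otimes>\<^bsub>?T\<^esub> t) w - (t \<otimes>\<^bsub>?T\<^esub> \<theta>) w + (t \<otimes>\<^bsub>?T\<^esub> t) w)"
      using t \<theta> by (simp add: tensor.l_minus tensor.r_minus) (simp add: tensor_uminus tensor_alg_simps(4))
    \<comment> \<open>Inclusion-exclusion: the coefficient at \<open>[a, b]\<close> counts
      \<open>b\<close> in \<open>D\<close> and \<open>a\<close> in \<open>D\<close> negatively and
      both together positively.\<close>
    also have "\<dots> = degree2_tensor C ?f"
      unfolding t_def \<theta>_def using D
      by (auto simp: degree1_tensor_mult fun_eq_iff degree2_tensor_def split: list.split)
    finally show ?thesis
      using t by (simp add: \<alpha> curvature_const_form \<theta>_def)
  qed
  also have "\<dots> = \<zero>\<^bsub>ext_alg G C\<^esub>"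
    by (intro const_form_eq_zero degree2_tensor_in_quad_ideal) (use stable in auto)
  finally show "flat_connection G C \<alpha>"
    using deg by (auto simp: flat_connection_def connection_def \<alpha> const_form_def form_deg_def)
qed

text \<open>Invariance is asked only of the sum of the two coefficients, since the braiding may move
  a contribution from one product to the other.\<close>

lemma degree1_forms_anticommute:
  assumes D: "D \<subseteq> C" and E: "E \<subseteq> C"
    and inv: "\<And>a b. \<lbrakk>a \<in> C; b \<in> C\<rbrakk> \<Longrightarrow>
      of_bool (a \<otimes> b \<otimes> inv a \<in> D \<and> a \<in> E) + of_bool (a \<otimes> b \<otimes> inv a \<in> E \<and> a \<in> D) =
      (of_bool (a \<in> D \<and> b \<in> E) + of_bool (a \<in> E \<and> b \<in> D) :: 'k::field)"
  defines "\<omega> \<equiv> (\<Oplus>\<^bsub>ext_alg G C\<^esub> a\<in>D. e_form G C a) :: ('a, 'k) form"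
    and "\<eta> \<equiv> (\<Oplus>\<^bsub>ext_alg G C\<^esub> a\<in>E. e_form G C a) :: ('a, 'k) form"
  shows "\<omega> \<otimes>\<^bsub>ext_alg G C\<^esub> \<eta> \<oplus>\<^bsub>ext_alg G C\<^esub> \<eta> \<otimes>\<^bsub>ext_alg G C\<^esub> \<omega> = \<zero>\<^bsub>ext_alg G C\<^esub>"
proof -
  let ?T = "tensor_alg C :: ('a list \<Rightarrow> 'k) ring"
  let ?f = "\<lambda>a b. of_bool (a \<in> D \<and> b \<in> E) + of_bool (a \<in> E \<and> b \<in> D) :: 'k"
  have "\<omega> \<otimes>\<^bsub>ext_alg G C\<^esub> \<eta> \<oplus>\<^bsub>ext_alg G C\<^esub> \<eta> \<otimes>\<^bsub>ext_alg G C\<^esub> \<omega> = const_form G C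
      (degree1_tensor D \<otimes>\<^bsub>?T\<^esub> degree1_tensor E \<oplus>\<^bsub>?T\<^esub> degree1_tensor E \<otimes>\<^bsub>?T\<^esub> degree1_tensor D)"
    using D E by (simp add: \<omega>_def \<eta>_def const_form_add const_form_mult degree1_tensor_closed
        const_form_degree1_tensor)
  also have "degree1_tensor D \<otimes>\<^bsub>?T\<^esub> degree1_tensor E \<oplus>\<^bsub>?T\<^esub> degree1_tensor E \<otimes>\<^bsub>?T\<^esub> degree1_tensor D
      = degree2_tensor C ?f"
    using D E by (auto simp: tensor_alg_simps(4) degree1_tensor_mult fun_eq_iff degree2_tensor_def
        split: list.split)
  also have "const_form G C (degree2_tensor C ?f) = \<zero>\<^bsub>ext_alg G C\<^esub>"
    by (intro const_form_eq_zero degree2_tensor_in_quad_ideal inv)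
  finally show ?thesis .
qed

end

section \<open>Conjugation of 2-cycles in the symmetric group\<close>

lemma conj_transpose:
  assumes "bij p"
  shows "p \<circ> transpose i j \<circ> inv_into UNIV p = transpose (p i) (p j)"
proof
  fix x
  \<comment> \<open>Writing the argument as \<open>p y\<close> cancels the inverse and leaves a
    comparison of \<open>y\<close> with \<open>i\<close> and \<open>j\<close>.\<close>
  obtain y where "x = p y" using assms by (metis bij_pointE)
  then show "(p \<circ> transpose i j \<circ> inv_into UNIV p) x = transpose (p i) (p j) x"
    using assms by (auto simp: transpose_def bij_is_inj inj_eq)
qed

lemma sym_group_conj:
  assumes "p \<in> carrier (sym_group N)"
  shows "p \<otimes>\<^bsub>sym_group N\<^esub> transpose i j \<otimes>\<^bsub>sym_group N\<^esub> inv\<^bsub>sym_group N\<^esub> p = transpose (p i) (p j)"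
  using conj_transpose[of p i j] assms
  by (simp add: sym_group_mult sym_group_carrier permutes_bij)

lemma two_cyclesE:
  assumes "a \<in> two_cycles N"
  obtains i j where "a = transpose i j" "i \<in> {1..N}" "j \<in> {1..N}" "i \<noteq> j"
  using assms by (auto simp: two_cycles_def)

lemma transpose_in_sym_group:
  "\<lbrakk>i \<in> {1..N}; j \<in> {1..N}\<rbrakk> \<Longrightarrow> transpose i j \<in> carrier (sym_group N)"
  by (simp add: sym_group_carrier permutes_swap_id)

lemma two_cycles_finite_conj_set: "finite_conj_set (sym_group N) (two_cycles N)"
proof -
  interpret group "sym_group N" by (rule sym_group_is_group)
  show ?thesis
  proof
    show "finite (carrier (sym_group N))"
      by (simp add: sym_group_def finite_permutations)
    show "two_cycles N \<subseteq> carrier (sym_group N)"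
      by (auto elim!: two_cyclesE intro!: transpose_in_sym_group)
    fix p a assume p: "p \<in> carrier (sym_group N)" and a: "a \<in> two_cycles N"
    obtain i j where ij: "a = transpose i j" "i \<in> {1..N}" "j \<in> {1..N}" "i \<noteq> j"
      using a by (rule two_cyclesE)
    have "p permutes {1..N}"
      using p by (simp add: sym_group_carrier)
    then have "p i \<in> {1..N}" "p j \<in> {1..N}" "p i \<noteq> p j"
      using ij permutes_in_image[of p "{1..N}"] permutes_inj[of p "{1..N}"]
      by (simp_all only: inj_eq) simp_all
    then show "p \<otimes>\<^bsub>sym_group N\<^esub> a \<otimes>\<^bsub>sym_group N\<^esub> inv\<^bsub>sym_group N\<^esub> p \<in> two_cycles N"
      unfolding ij(1) sym_group_conj[OF p] two_cycles_def by blast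
  qed
qed

text \<open>These are the 2-cycles occurring in \<open>theta_S N i\<close>. Describing them by the
  condition of moving \<open>i\<close> makes their behaviour under conjugation easy to
  follow.\<close>

definition star :: "nat \<Rightarrow> nat \<Rightarrow> (nat \<Rightarrow> nat) set" where
  "star N i = {a \<in> two_cycles N. a i \<noteq> i}"

lemma transpose_moves_iff: "i \<noteq> j \<Longrightarrow> transpose i j k \<noteq> k \<longleftrightarrow> k = i \<or> k = j"
  by (auto simp: transpose_def)

lemma star_eq_image: "i \<in> {1..N} \<Longrightarrow> star N i = transpose i ` ({1..N} - {i})"
  by (fastforce simp: star_def two_cycles_def transpose_moves_iff transpose_commute)

lemma inj_on_transpose: "inj_on (transpose i) A"
  by (rule inj_onI) (metis transpose_apply_first)

text \<open>The sum over \<open>j\<close> is reindexed along \<open>transpose i\<close>, which is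
  injective, so no 2-cycle is counted twice.\<close>

lemma theta_S_eq:
  assumes "i \<in> {1..N}"
  shows "theta_S N i = (\<Oplus>\<^bsub>Omega_S N\<^esub> a\<in>star N i. e_form (sym_group N) (two_cycles N) a)"
proof -
  interpret finite_conj_set "sym_group N" "two_cycles N" by (rule two_cycles_finite_conj_set)
  interpret E: abelian_group "Omega_S N" by (rule ext_alg_abelian_group)
  have "e_form (sym_group N) (two_cycles N) \<in> star N i \<rightarrow> carrier (Omega_S N)"
    by (auto simp: e_form_def star_def intro!: const_form_closed word_tensor_closed)
  then show ?thesis
    unfolding theta_S_def star_eq_image[OF assms]
    by (subst E.finsum_reindex) (auto simp: inj_on_transpose)
qed

theorem proposition3p4:
  fixes N :: nat
  assumes "N \<ge> 2"
  shows "(\<forall>i\<in>{1..N}.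
            flat_connection (sym_group N) (two_cycles N)
              (alpha_S N i :: (nat \<Rightarrow> nat, 'k::field_char_0) form) \<and>
            constant_coeffs (sym_group N) (two_cycles N)
              (alpha_S N i :: (nat \<Rightarrow> nat, 'k) form)) \<and>
         (\<forall>i\<in>{1..N}. \<forall>j\<in>{1..N}. i \<noteq> j \<longrightarrow>
            theta_S N i \<otimes>\<^bsub>Omega_S N\<^esub> theta_S N j
              \<oplus>\<^bsub>Omega_S N\<^esub> theta_S N j \<otimes>\<^bsub>Omega_S N\<^esub> theta_S N i
              = (\<zero>\<^bsub>Omega_S N\<^esub> :: (nat \<Rightarrow> nat, 'k) form))"
proof -
  interpret finite_conj_set "sym_group N" "two_cycles N" by (rule two_cycles_finite_conj_set)
  let ?conj = "\<lambda>a b. a \<otimes>\<^bsub>sym_group N\<^esub> b \<otimes>\<^bsub>sym_group N\<^esub> inv\<^bsub>sym_group N\<^esub> a"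
  have star_subset: "star N i \<subseteq> two_cycles N" for i
    by (auto simp: star_def)
  have in_star: "a \<in> star N i \<longleftrightarrow> a i \<noteq> i" if "a \<in> two_cycles N" for a i
    using that by (simp add: star_def)
  \<comment> \<open>As \<open>a\<close> is its own inverse, the conjugate sends \<open>i\<close> to
    \<open>a (b (a i))\<close>, which equals \<open>i\<close> exactly when \<open>b\<close> fixes
    \<open>a i\<close>.\<close>
  have conj_star: "?conj a b \<in> star N i \<longleftrightarrow> b (a i) \<noteq> a i"
    if a: "a \<in> two_cycles N" and b: "b \<in> two_cycles N" for a b i
  proof -
    have "a \<in> carrier (sym_group N)" using a by (rule C_carrier)
    moreover from this have "bij a" by (simp add: sym_group_carrier permutes_bij)
    moreover have "inv_into UNIV a = a"
      using a by (auto elim!: two_cyclesE)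
    moreover have "a (a i) = i" using a by (auto elim!: two_cyclesE)
    ultimately show ?thesis
      using in_star[OF conj_closed[of a b], of i] b
      by (simp add: sym_group_mult) (metis bij_pointE bij_is_inj inj_eq)
  qed
  have "flat_connection (sym_group N) (two_cycles N) (alpha_S N i :: (nat \<Rightarrow> nat, 'k) form) \<and>
      constant_coeffs (sym_group N) (two_cycles N) (alpha_S N i :: (nat \<Rightarrow> nat, 'k) form)"
    if i: "i \<in> {1..N}" for i
    unfolding alpha_S_def theta_S_eq[OF i]
    \<comment> \<open>A 2-cycle \<open>a\<close> outside \<open>star N i\<close> fixes
      \<open>i\<close>, so by \<open>conj_star\<close> the conjugate of \<open>b\<close> moves
      \<open>i\<close> exactly when \<open>b\<close> does.\<close>
    by (intro conjI flat_connection_uminus_degree1 star_subset) (auto simp: conj_star in_star)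
  moreover have "theta_S N i \<otimes>\<^bsub>Omega_S N\<^esub> theta_S N j \<oplus>\<^bsub>Omega_S N\<^esub> theta_S N j \<otimes>\<^bsub>Omega_S N\<^esub> theta_S N i
      = (\<zero>\<^bsub>Omega_S N\<^esub> :: (nat \<Rightarrow> nat, 'k) form)"
    if i: "i \<in> {1..N}" and j: "j \<in> {1..N}" and "i \<noteq> j" for i j
    unfolding theta_S_eq[OF i] theta_S_eq[OF j]
  proof (intro degree1_forms_anticommute star_subset)
    fix a b assume a: "a \<in> two_cycles N" and b: "b \<in> two_cycles N"
    have "a i = j \<and> a j = i" if "a i \<noteq> i" "a j \<noteq> j"
      using a that \<open>i \<noteq> j\<close> by (auto elim!: two_cyclesE simp: transpose_def split: if_splits)
    then show "of_bool (?conj a b \<in> star N i \<and> a \<in> star N j) + of_bool (?conj a b \<in> star N j \<and> a \<in> star N i) =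
      (of_bool (a \<in> star N i \<and> b \<in> star N j) + of_bool (a \<in> star N j \<and> b \<in> star N i) :: 'k)"
      \<comment> \<open>If \<open>a\<close> fixes both points, all terms vanish. If it moves exactly
        one, the surviving term passes from one summand to the other. If it swaps them, each summand
        keeps its value.\<close>
      using a b by (cases "a i = i"; cases "a j = j") (auto simp: conj_star in_star)
  qed
  ultimately show ?thesis by blast
qed

end
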